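(* Let $O_4$ be the Odd graph and $W$ the truncated Witt graph. Then $$h_3(4)\ge |E(O_4)|+1=71>4^3-4^2+4+2=54$$ and $$h_3(15)\ge |E(W)|+1=3796>15^3-15^2+15+2=3167.$$ In particular, the inequality $h_3(\Delta)\le\Delta^3-\Delta^2+\Delta+2$ fails for $\Delta=4$ and for $\Delta=15$.
   Context: All graphs are finite and simple. $\Delta(G)$ is the maximum degree of $G$ and $L(G)$ is the line graph of $G$. For a positive integer $k$, the $k$-th power $F^k$ of a graph $F$ has vertex set $V(F)$, and two distinct vertices are adjacent in $F^k$ if and only if they are at distance at most $k$ in $F$. For positive integers $\Delta$ and $t$, the integer $h_t(\Delta)$ is defined by $$h_t(\Delta)-1:=\max_G\{\,|E(G)| : \Delta(G)\le\Delta,\ L(G)^t \text{ is a complete graph}\,\}.$$ The Odd graph $O_4$ (the Kneser graph $KG(7,3)$) has as vertices the $3$-element subsets of $\{1,\dots,7\}$, two being adjacent precisely when they are disjoint. Let $\Omega$ be a set of $24$ points and $\mathcal{O}$ a collection of $8$-subsets of $\Omega$ (octads) forming a Steiner system $S(5,8,24)$, i.e. every $5$-subset of $\Omega$ is contained in exactly one octad. Fix an element $\infty\in\Omega$. The truncated Witt graph $W$ has as vertices the octads in $\mathcal{O}$ not containing $\infty$, two being adjacent if and only if they are disjoint. *)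

theory Defs
  imports Main "HOL-Library.Extended_Nat"
begin

record 'a sgraph =
  verts :: "'a set"
  edges :: "'a set set"

definition fin_simple_graph :: "'a sgraph \<Rightarrow> bool" where
  "fin_simple_graph G \<longleftrightarrow>
     finite (verts G) \<and> (\<forall>e \<in> edges G. e \<subseteq> verts G \<and> card e = 2)"

definition degree :: "'a sgraph \<Rightarrow> 'a \<Rightarrow> nat" where
  "degree G v = card {e \<in> edges G. v \<in> e}"

text \<open>The inserted 0 only matters for the graph without vertices.\<close>

definition max_degree :: "'a sgraph \<Rightarrow> nat" where
  "max_degree G = Max (insert 0 (degree G ` verts G))"

definition line_graph :: "'a sgraph \<Rightarrow> 'a set sgraph" where
  "line_graph G =
     \<lparr> verts = edges G,
       edges = {{e, f} |e f. e \<in> edges G \<and> f \<in> edges G \<and> e \<noteq> f \<and> e \<inter> f \<noteq> {}} \<rparr>"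

definition walk_between :: "'a sgraph \<Rightarrow> 'a \<Rightarrow> 'a list \<Rightarrow> 'a \<Rightarrow> bool" where
  "walk_between G u xs v \<longleftrightarrow>
     xs \<noteq> [] \<and> hd xs = u \<and> last xs = v \<and> set xs \<subseteq> verts G \<and>
     successively (\<lambda>x y. {x, y} \<in> edges G) xs"

text \<open>Walks are lists of vertices, so the number of edges is one less than the
  length of the list. Vertices in different components have distance \<open>\<infinity>\<close>.\<close>

definition graph_dist :: "'a sgraph \<Rightarrow> 'a \<Rightarrow> 'a \<Rightarrow> enat" where
  "graph_dist G u v = (INF xs \<in> {xs. walk_between G u xs v}. enat (length xs - 1))"

definition graph_power :: "'a sgraph \<Rightarrow> nat \<Rightarrow> 'a sgraph" where
  "graph_power F k =
     \<lparr> verts = verts F,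
       edges = {{u, v} |u v. u \<in> verts F \<and> v \<in> verts F \<and> u \<noteq> v \<and>
                              graph_dist F u v \<le> enat k} \<rparr>"

definition complete_graph :: "'a sgraph \<Rightarrow> bool" where
  "complete_graph G \<longleftrightarrow> (\<forall>u \<in> verts G. \<forall>v \<in> verts G. u \<noteq> v \<longrightarrow> {u, v} \<in> edges G)"

text \<open>Every finite graph is isomorphic to one whose vertices are natural numbers,
  so the maximum is taken over these. \<^const>\<open>Max\<close> is meaningful only
  for finite nonempty sets; here the number of edges is bounded in terms of
  \<open>\<Delta>\<close> and \<open>t\<close>.\<close>

definition h :: "nat \<Rightarrow> nat \<Rightarrow> nat" where
  "h t \<Delta> = Max {card (edges G) |G :: nat sgraph.
       fin_simple_graph G \<and> max_degree G \<le> \<Delta> \<and>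
       complete_graph (graph_power (line_graph G) t)} + 1"

definition disjointness_graph :: "'a set set \<Rightarrow> 'a set sgraph" where
  "disjointness_graph F =
     \<lparr> verts = F,
       edges = {{A, B} |A B. A \<in> F \<and> B \<in> F \<and> A \<noteq> B \<and> A \<inter> B = {}} \<rparr>"

definition kneser_graph :: "nat \<Rightarrow> nat \<Rightarrow> nat set sgraph" where
  "kneser_graph n k = disjointness_graph {A. A \<subseteq> {1..n} \<and> card A = k}"

definition odd_graph_4 :: "nat set sgraph" where
  "odd_graph_4 = kneser_graph 7 3"

definition steiner_system :: "nat \<Rightarrow> nat \<Rightarrow> nat \<Rightarrow> 'a set \<Rightarrow> 'a set set \<Rightarrow> bool" where
  "steiner_system t k n \<Omega> \<O> \<longleftrightarrow>
     finite \<Omega> \<and> card \<Omega> = n \<and>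
     (\<forall>B \<in> \<O>. B \<subseteq> \<Omega> \<and> card B = k) \<and>
     (\<forall>T. T \<subseteq> \<Omega> \<and> card T = t \<longrightarrow> (\<exists>!B. B \<in> \<O> \<and> T \<subseteq> B))"

definition truncated_witt_graph :: "'a set set \<Rightarrow> 'a \<Rightarrow> 'a set sgraph" where
  "truncated_witt_graph \<O> p = disjointness_graph {B \<in> \<O>. p \<notin> B}"

end

theory Submission
  imports Defs "HOL-Library.FuncSet"
begin

text \<open>
  A graph with many edges whose line graph has a complete cube forces a lower
  bound on \<open>h 3 \<Delta>\<close>, provided that the maximum defining \<open>h\<close> exists. It does: in \<open>L(G)\<close> the
  edges within distance \<open>t\<close> of a given one number at most \<open>(2\<Delta>)\<^sup>t\<close>
  (\<open>card_line_ball_le\<close>), so completeness of \<open>L(G)\<^sup>t\<close> bounds \<open>|E(G)|\<close>.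

  Two edges are at distance at most 3 in \<open>L(G)\<close> as soon as some endpoint of the one is at
  distance at most 2 in \<open>G\<close> from some endpoint of the other (\<open>complete_line_cube\<close>). Both
  example graphs live on a family of \<open>k\<close>-sets with disjointness as adjacency, and the same
  argument serves for both. Let \<open>AB\<close> and \<open>CD\<close> be edges such that
  each of \<open>A, B\<close> is at distance at least 3 from each of \<open>C, D\<close>. This forces all four
  intersection sizes to equal a constant, 1 for \<open>O\<^sub>4\<close> and 2 for \<open>W\<close>. Hence
  \<open>C\<close> and \<open>D\<close> each have \<open>k - 2\<close>, respectively \<open>k - 4\<close>, points in the complement
  \<open>T\<close> of \<open>A \<union> B\<close>, and these two parts are disjoint. For \<open>O\<^sub>4\<close> the set \<open>T\<close> is a
  single point; for \<open>W\<close> it has 8 points, and one of them, the deleted point \<open>\<infinity>\<close>,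
  belongs to neither part, which leaves too little room for \<open>4 + 4\<close> points.

  For \<open>W\<close> this needs some facts about an arbitrary \<open>S(5,8,24)\<close>. Double counting gives the
  replication numbers 759, 253, 77, 21, 5, 1 and then the number of octads that avoid \<open>\<infinity>\<close> and
  meet a given octad in a given number of points (\<open>others_profile\<close>); in particular \<open>W\<close> is
  15-regular on 506 vertices and two octads meet evenly. A divisibility argument shows that
  every 8-set meeting all octads evenly is itself an octad (\<open>octad_if_even\<close>), which supplies a
  common neighbour in \<open>W\<close> for two octads meeting in 4 points (\<open>common_nbr_of_tetrad\<close>).

  The unconditional bound on \<open>h 3 15\<close> also needs one \<open>S(5,8,24)\<close> to exist.
  It consists of the words of weight 8 in the extended binary Golay code, built by
  Turyn's construction from two Hamming codes. The code has \<open>2\<^sup>1\<^sup>2\<close> words, all of even weight, and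
  minimum weight 8, so the sums of a word and a set of 1 or 3 points are pairwise different; there are
  \<open>2\<^sup>1\<^sup>2 \<sqdot> 2\<^sup>1\<^sup>1\<close> of them, and they exhaust the \<open>2\<^sup>2\<^sup>3\<close> sets of odd size. That every 5-set is such a sum
  is the covering property of the octads (\<open>steiner_system_of_code\<close>).
\<close>

section \<open>Distances in line graphs and the maximum \<open>h\<close>\<close>

lemma walk_between_rev:
  assumes "walk_between G u xs v"
  shows "walk_between G v (rev xs) u"
  using assms by (simp add: walk_between_def hd_rev last_rev insert_commute)

text \<open>
  The infimum in the definition of distance is attained because \<^typ>\<open>enat\<close> is well-ordered; the
  infimum of the empty set is \<open>\<infinity>\<close>, so a finite bound produces a walk.
\<close>

lemma graph_dist_le_iff:
  "graph_dist G u v \<le> enat k \<longleftrightarrow> (\<exists>xs. walk_between G u xs v \<and> length xs \<le> Suc k)"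
proof
  assume le: "graph_dist G u v \<le> enat k"
  let ?D = "(\<lambda>xs. enat (length xs - 1)) ` {xs. walk_between G u xs v}"
  have "?D \<noteq> {}"
  proof
    assume "?D = {}"
    then have "graph_dist G u v = \<infinity>" unfolding graph_dist_def by (simp add: top_enat_def)
    with le show False by simp
  qed
  then have "graph_dist G u v \<in> ?D"
    unfolding graph_dist_def by (metis (no_types, lifting) ex_in_conv wellorder_InfI)
  then show "\<exists>xs. walk_between G u xs v \<and> length xs \<le> Suc k" using le by auto
next
  assume "\<exists>xs. walk_between G u xs v \<and> length xs \<le> Suc k"
  then obtain xs where "walk_between G u xs v" "length xs \<le> Suc k" by blast
  then show "graph_dist G u v \<le> enat k"
    unfolding graph_dist_def by (intro INF_lower2[of xs]) auto
qed

lemma graph_dist_commute: "graph_dist G u v \<le> enat k \<longleftrightarrow> graph_dist G v u \<le> enat k"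
  unfolding graph_dist_le_iff by (metis length_rev walk_between_rev)

text \<open>
  Balls of the line graph described by \<open>G\<close> alone. Consecutive edges may coincide, so for
  nonempty edges the balls grow with the radius, and images under injective maps of
  the vertices are immediate.
\<close>

fun line_ball :: "'a sgraph \<Rightarrow> 'a set \<Rightarrow> nat \<Rightarrow> 'a set set" where
  "line_ball G e 0 = {e}"
| "line_ball G e (Suc k) = {f \<in> edges G. \<exists>g \<in> line_ball G e k. g \<inter> f \<noteq> {}}"

lemma edges_line_graph:
  "{e, f} \<in> edges (line_graph G) \<longleftrightarrow> e \<in> edges G \<and> f \<in> edges G \<and> e \<noteq> f \<and> e \<inter> f \<noteq> {}"
  by (auto simp: line_graph_def doubleton_eq_iff)

lemma graph_dist_line_graph:
  assumes G: "{} \<notin> edges G" and e: "e \<in> edges G"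
  shows "graph_dist (line_graph G) e f \<le> enat k \<longleftrightarrow> f \<in> line_ball G e k"
  unfolding graph_dist_le_iff
proof (induction k arbitrary: f)
  case 0
  have "xs = [hd xs]" if "walk_between (line_graph G) e xs f" "length xs \<le> Suc 0" for xs
    using that by (cases xs) (auto simp: walk_between_def)
  then have "f = e" if "walk_between (line_graph G) e xs f" "length xs \<le> Suc 0" for xs
    using that by (metis walk_between_def last_ConsL)
  moreover have "walk_between (line_graph G) e [e] e"
    using e by (simp add: walk_between_def line_graph_def)
  ultimately show ?case by (auto intro: exI[of _ "[e]"])
next
  case (Suc k)
  show ?case
  proof
    assume "\<exists>xs. walk_between (line_graph G) e xs f \<and> length xs \<le> Suc (Suc k)"
    then obtain xs where xs: "walk_between (line_graph G) e xs f" "length xs \<le> Suc (Suc k)"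
      by blast
    then have f: "f \<in> edges G" by (auto simp: walk_between_def line_graph_def)
    obtain ys where ys: "xs = ys @ [f]"
      using xs by (metis append_butlast_last_id walk_between_def)
    show "f \<in> line_ball G e (Suc k)"
    proof (cases "ys = []")
      case True
      then have "walk_between (line_graph G) e [f] f" using xs ys by simp
      then have "f \<in> line_ball G e k" using Suc.IH by fastforce
      then show ?thesis using f G by (auto intro!: bexI[of _ f])
    next
      case False
      then have "walk_between (line_graph G) e ys (last ys)"
        and adj: "{last ys, f} \<in> edges (line_graph G)"
        using xs ys by (auto simp: walk_between_def successively_append_iff)
      then have "last ys \<in> line_ball G e k" using Suc.IH xs ys by auto
      then show ?thesis using adj by (auto simp: edges_line_graph)
    qed
  next
    assume "f \<in> line_ball G e (Suc k)"
    then obtain g where f: "f \<in> edges G" and g: "g \<in> line_ball G e k" "g \<inter> f \<noteq> {}" by auto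
    obtain xs where xs: "walk_between (line_graph G) e xs g" "length xs \<le> Suc k"
      using Suc.IH g(1) by blast
    show "\<exists>xs. walk_between (line_graph G) e xs f \<and> length xs \<le> Suc (Suc k)"
    proof (cases "g = f")
      case False
      have "g \<in> edges G" using xs by (auto simp: walk_between_def line_graph_def)
      then have "{g, f} \<in> edges (line_graph G)" using False f g by (simp add: edges_line_graph)
      then have "walk_between (line_graph G) e (xs @ [f]) f"
        using xs f by (auto simp: walk_between_def successively_append_iff line_graph_def)
      then show ?thesis using xs by (intro exI[of _ "xs @ [f]"]) simp
    qed (use xs in auto)
  qed
qed

lemma empty_notin_edges: "fin_simple_graph G \<Longrightarrow> {} \<notin> edges G"
  by (auto simp: fin_simple_graph_def)

lemma complete_line_power_iff:
  assumes "fin_simple_graph G"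
  shows "complete_graph (graph_power (line_graph G) t) \<longleftrightarrow>
    (\<forall>e \<in> edges G. \<forall>f \<in> edges G. e \<noteq> f \<longrightarrow> f \<in> line_ball G e t)"
proof -
  have "{e, f} \<in> edges (graph_power (line_graph G) t) \<longleftrightarrow> f \<in> line_ball G e t"
    if ef: "e \<in> edges G" "f \<in> edges G" "e \<noteq> f" for e f
  proof -
    have "{e, f} \<in> edges (graph_power (line_graph G) t) \<longleftrightarrow> graph_dist (line_graph G) e f \<le> enat t"
      using ef graph_dist_commute[of "line_graph G"]
      by (auto simp: graph_power_def line_graph_def doubleton_eq_iff)
    then show ?thesis
      using graph_dist_line_graph[OF empty_notin_edges[OF assms] ef(1)] by simp
  qed
  then show ?thesis by (auto simp: complete_graph_def graph_power_def line_graph_def)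
qed

lemma finite_edges: "fin_simple_graph G \<Longrightarrow> finite (edges G)"
  unfolding fin_simple_graph_def by (meson Pow_iff finite_Pow_iff finite_subset subsetI)

lemma max_degree_le_iff:
  assumes "fin_simple_graph G"
  shows "max_degree G \<le> \<Delta> \<longleftrightarrow> (\<forall>v \<in> verts G. degree G v \<le> \<Delta>)"
  using assms by (auto simp: max_degree_def fin_simple_graph_def)

text \<open>
  An edge \<open>uv\<close> meets only edges at \<open>u\<close> or at \<open>v\<close>, at most \<open>2\<Delta>\<close> in number, so each step of the radius
  costs a factor of at most \<open>2\<Delta>\<close>.
\<close>

lemma card_line_ball_le:
  assumes G: "fin_simple_graph G" and deg: "max_degree G \<le> \<Delta>" and e: "e \<in> edges G"
  shows "card (line_ball G e k) \<le> (2 * \<Delta>) ^ k"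
proof (induction k)
  case (Suc k)
  have ball: "line_ball G e k \<subseteq> edges G" using e by (cases k) auto
  then have fin: "finite (line_ball G e k)" using finite_edges[OF G] finite_subset by blast
  have "line_ball G e (Suc k) = (\<Union>g \<in> line_ball G e k. {f \<in> edges G. g \<inter> f \<noteq> {}})" by auto
  then have "card (line_ball G e (Suc k)) \<le> (\<Sum>g \<in> line_ball G e k. card {f \<in> edges G. g \<inter> f \<noteq> {}})"
    using card_UN_le[OF fin, of "\<lambda>g. {f \<in> edges G. g \<inter> f \<noteq> {}}"] by (simp only:)
  also have "\<dots> \<le> (\<Sum>g \<in> line_ball G e k. 2 * \<Delta>)"
  proof (rule sum_mono)
    fix g assume "g \<in> line_ball G e k"
    then have "g \<subseteq> verts G" "card g = 2" using ball G by (auto simp: fin_simple_graph_def)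
    then obtain u v where uv: "g = {u, v}" "u \<in> verts G" "v \<in> verts G"
      by (auto simp: card_2_iff)
    have "{f \<in> edges G. g \<inter> f \<noteq> {}} = {f \<in> edges G. u \<in> f} \<union> {f \<in> edges G. v \<in> f}"
      using uv by auto
    then have "card {f \<in> edges G. g \<inter> f \<noteq> {}} \<le> degree G u + degree G v"
      unfolding degree_def by (simp only: card_Un_le)
    also have "\<dots> \<le> 2 * \<Delta>" using bspec[OF deg[unfolded max_degree_le_iff[OF G]]] uv by (simp add: add_mono mult_2)
    finally show "card {f \<in> edges G. g \<inter> f \<noteq> {}} \<le> 2 * \<Delta>" .
  qed
  also have "\<dots> \<le> (2 * \<Delta>) ^ Suc k" using Suc.IH by simp
  finally show ?case .
qed simp

lemma card_edges_le_of_complete: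
  assumes "fin_simple_graph G" "max_degree G \<le> \<Delta>"
    and "complete_graph (graph_power (line_graph G) t)"
  shows "card (edges G) \<le> (2 * \<Delta>) ^ t + 1"
proof (cases "edges G = {}")
  case False
  then obtain e where e: "e \<in> edges G" by blast
  have "edges G \<subseteq> insert e (line_ball G e t)"
    using assms(3) e unfolding complete_line_power_iff[OF assms(1)] by blast
  moreover have "finite (line_ball G e t)"
    using e finite_edges[OF assms(1)] by (cases t) auto
  ultimately have "card (edges G) \<le> card (insert e (line_ball G e t))" by (intro card_mono) auto
  also have "\<dots> \<le> Suc (card (line_ball G e t))" using \<open>finite (line_ball G e t)\<close> by (simp add: card_insert_if)
  finally have "card (edges G) \<le> Suc (card (line_ball G e t))" .
  then show ?thesis using card_line_ball_le[OF assms(1,2) e, of t] by linarith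
next
  case True
  then show ?thesis by simp
qed

lemma card_edges_less_h_nat:
  fixes G :: "nat sgraph"
  assumes "fin_simple_graph G" "max_degree G \<le> \<Delta>"
    and "complete_graph (graph_power (line_graph G) t)"
  shows "card (edges G) + 1 \<le> h t \<Delta>"
proof -
  define S where "S = {card (edges G) |G :: nat sgraph. fin_simple_graph G \<and> max_degree G \<le> \<Delta> \<and>
       complete_graph (graph_power (line_graph G) t)}"
  have "s \<le> (2 * \<Delta>) ^ t + 1" if "s \<in> S" for s
    using that card_edges_le_of_complete unfolding S_def by fastforce
  then have "finite S" by (meson finite_nat_set_iff_bounded_le)
  moreover have "card (edges G) \<in> S" using assms unfolding S_def by blast
  ultimately have "card (edges G) \<le> Max S" by (rule Max_ge)
  then show ?thesis unfolding h_def S_def by simp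
qed

text \<open>
  In \<open>h\<close> only graphs on natural numbers compete. A finite graph on any type is carried to
  one of those by an injective numbering of its vertices, and line graph balls are carried along.
\<close>

lemma card_edges_less_h:
  fixes G :: "'b sgraph"
  assumes G: "fin_simple_graph G" and deg: "max_degree G \<le> \<Delta>"
    and compl: "complete_graph (graph_power (line_graph G) t)"
  shows "card (edges G) + 1 \<le> h t \<Delta>"
proof -
  have V: "finite (verts G)" and E: "\<And>e. e \<in> edges G \<Longrightarrow> e \<subseteq> verts G \<and> card e = 2"
    using G by (auto simp: fin_simple_graph_def)
  obtain \<phi> :: "'b \<Rightarrow> nat" where \<phi>: "inj_on \<phi> (verts G)"
    using finite_imp_inj_to_nat_seg[OF V] by blast
  define H where "H = \<lparr>verts = \<phi> ` verts G, edges = (`) \<phi> ` edges G\<rparr>"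
  then have EH: "edges H = (`) \<phi> ` edges G" by simp
  have injE: "inj_on ((`) \<phi>) (edges G)"
    using inj_on_image_Pow[OF \<phi>] E by (auto intro: inj_on_subset)
  have H: "fin_simple_graph H"
    unfolding fin_simple_graph_def
    using V E \<phi> by (auto simp: H_def card_image inj_on_subset)
  have "degree H (\<phi> v) = degree G v" if v: "v \<in> verts G" for v
  proof -
    have "{e \<in> edges H. \<phi> v \<in> e} = (`) \<phi> ` {e \<in> edges G. v \<in> e}"
    proof -
      have "\<phi> v \<in> \<phi> ` e \<longleftrightarrow> v \<in> e" if "e \<in> edges G" for e
        using inj_on_image_mem_iff[OF \<phi> v] E[OF that] by blast
      then show ?thesis by (simp add: H_def Compr_image_eq cong: conj_cong)
    qed
    moreover have "inj_on ((`) \<phi>) {e \<in> edges G. v \<in> e}"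
      using injE by (rule inj_on_subset) auto
    ultimately show ?thesis by (simp add: degree_def card_image)
  qed
  then have "max_degree H \<le> \<Delta>"
    using deg unfolding max_degree_le_iff[OF G] max_degree_le_iff[OF H] by (simp add: H_def)
  moreover have ball: "\<phi> ` f \<in> line_ball H (\<phi> ` e) k" if "f \<in> line_ball G e k" for e f k
    using that
  proof (induction k arbitrary: f)
    case (Suc k)
    then obtain g where "f \<in> edges G" "g \<in> line_ball G e k" "g \<inter> f \<noteq> {}" by auto
    then have "\<phi> ` f \<in> edges H" "\<phi> ` g \<in> line_ball H (\<phi> ` e) k" "\<phi> ` g \<inter> \<phi> ` f \<noteq> {}"
      using Suc.IH by (auto simp: H_def)
    then show ?case by auto
  qed simp
  then have "complete_graph (graph_power (line_graph H) t)"
    using compl unfolding complete_line_power_iff[OF G] complete_line_power_iff[OF H] EH by blast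
  ultimately have "card (edges H) + 1 \<le> h t \<Delta>" using card_edges_less_h_nat[OF H] by blast
  then show ?thesis using injE by (simp add: H_def card_image)
qed

section \<open>Line graphs with a complete cube, and disjointness graphs\<close>

text \<open>
  If \<open>u \<in> e\<close> and \<open>v \<in> f\<close> have a common neighbour \<open>w\<close>, then \<open>e, uw, wv, f\<close> is a walk of
  length 3 in the line graph. The two nearer cases give shorter walks, padded by repeating \<open>e\<close>.
\<close>

lemma complete_line_cube:
  assumes G: "fin_simple_graph G"
    and close: "\<And>e f. e \<in> edges G \<Longrightarrow> f \<in> edges G \<Longrightarrow>
      \<exists>u \<in> e. \<exists>v \<in> f. u = v \<or> {u, v} \<in> edges G \<or> (\<exists>w. {u, w} \<in> edges G \<and> {w, v} \<in> edges G)"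
  shows "complete_graph (graph_power (line_graph G) 3)"
proof -
  have step: "f \<in> line_ball G e (Suc k)"
    if "g \<in> line_ball G e k" "f \<in> edges G" "x \<in> g" "x \<in> f" for e f g k x
    using that by auto
  have "f \<in> line_ball G e (Suc (Suc (Suc 0)))" if e: "e \<in> edges G" and f: "f \<in> edges G" for e f
  proof -
    have e0: "e \<in> line_ball G e 0" by simp
    from close[OF e f] obtain u v where uv: "u \<in> e" "v \<in> f"
      and "u = v \<or> {u, v} \<in> edges G \<or> (\<exists>w. {u, w} \<in> edges G \<and> {w, v} \<in> edges G)" by blast
    then consider "u = v" | "{u, v} \<in> edges G" | w where "{u, w} \<in> edges G" "{w, v} \<in> edges G"
      by blast
    then show ?thesis
    proof cases
      case 1
      from step[OF e0 e uv(1) uv(1)] have "e \<in> line_ball G e (Suc 0)" .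
      from step[OF this e uv(1) uv(1)] have "e \<in> line_ball G e (Suc (Suc 0))" .
      from step[OF this f uv(1)] show ?thesis using uv 1 by simp
    next
      case 2
      from step[OF e0 e uv(1) uv(1)] have "e \<in> line_ball G e (Suc 0)" .
      from step[OF this 2 uv(1)] have "{u, v} \<in> line_ball G e (Suc (Suc 0))" by simp
      from step[OF this f _ uv(2)] show ?thesis by simp
    next
      case 3
      from step[OF e0 3(1) uv(1)] have "{u, w} \<in> line_ball G e (Suc 0)" by simp
      from step[OF this 3(2), of w] have "{w, v} \<in> line_ball G e (Suc (Suc 0))" by simp
      from step[OF this f _ uv(2)] show ?thesis by simp
    qed
  qed
  then show ?thesis unfolding complete_line_power_iff[OF G] by (simp add: eval_nat_numeral)
qed

lemma edges_disjointness_graph: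
  assumes "{} \<notin> F"
  shows "{A, B} \<in> edges (disjointness_graph F) \<longleftrightarrow> A \<in> F \<and> B \<in> F \<and> A \<inter> B = {}"
proof
  assume "A \<in> F \<and> B \<in> F \<and> A \<inter> B = {}"
  moreover from this have "A \<noteq> B" using assms by auto
  ultimately show "{A, B} \<in> edges (disjointness_graph F)"
    unfolding disjointness_graph_def by (simp, blast)
qed (auto simp: disjointness_graph_def doubleton_eq_iff)

lemma fin_simple_disjointness_graph:
  assumes "finite F"
  shows "fin_simple_graph (disjointness_graph F)"
  unfolding fin_simple_graph_def
proof (intro conjI ballI)
  fix e assume "e \<in> edges (disjointness_graph F)"
  then obtain A B where e: "e = {A, B}" and AB: "A \<in> F" "B \<in> F" "A \<noteq> B"
    by (auto simp: disjointness_graph_def)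
  then show "e \<subseteq> verts (disjointness_graph F)" by (simp add: disjointness_graph_def)
  show "card e = 2" using e AB(3) by simp
qed (use assms in \<open>simp add: disjointness_graph_def\<close>)

lemma degree_disjointness_graph:
  assumes "{} \<notin> F" "A \<in> F"
  shows "degree (disjointness_graph F) A = card {B \<in> F. A \<inter> B = {}}"
proof -
  have "{e \<in> edges (disjointness_graph F). A \<in> e} = (\<lambda>B. {A, B}) ` {B \<in> F. A \<inter> B = {}}"
  proof (intro set_eqI iffI)
    fix e assume e: "e \<in> {e \<in> edges (disjointness_graph F). A \<in> e}"
    then have "e \<in> edges (disjointness_graph F)" "A \<in> e" by auto
    moreover from this(1) obtain C D where "e = {C, D}"
      unfolding disjointness_graph_def by (simp, blast)
    ultimately obtain B where "e = {A, B}" by blast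
    then show "e \<in> (\<lambda>B. {A, B}) ` {B \<in> F. A \<inter> B = {}}"
      using e edges_disjointness_graph[OF assms(1)] by auto
  qed (use assms edges_disjointness_graph[OF assms(1)] in auto)
  moreover have "inj_on (\<lambda>B. {A, B}) {B \<in> F. A \<inter> B = {}}"
    by (auto simp: inj_on_def doubleton_eq_iff)
  ultimately show ?thesis by (simp add: degree_def card_image)
qed

lemma sum_degree:
  assumes "fin_simple_graph G"
  shows "(\<Sum>v \<in> verts G. degree G v) = 2 * card (edges G)"
proof -
  have "{v \<in> verts G. v \<in> e} = e" if "e \<in> edges G" for e
    using that assms by (auto simp: fin_simple_graph_def)
  then have "\<forall>e \<in> edges G. card {v \<in> verts G. v \<in> e} = 2"
    using assms by (simp add: fin_simple_graph_def)
  then show ?thesis unfolding degree_def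
    using assms finite_edges by (intro sum_multicount) (auto simp: fin_simple_graph_def)
qed

text \<open>
  For members of a family \<open>F\<close> of nonempty sets this is distance at most 2 in the disjointness
  graph of \<open>F\<close>.
\<close>

definition within_two :: "'a set set \<Rightarrow> 'a set \<Rightarrow> 'a set \<Rightarrow> bool" where
  "within_two F A C \<longleftrightarrow> A = C \<or> A \<inter> C = {} \<or> (\<exists>Z \<in> F. A \<inter> Z = {} \<and> Z \<inter> C = {})"

lemma regular_disjointness_graph:
  fixes F :: "'b set set"
  assumes F: "finite F" "{} \<notin> F"
    and reg: "\<And>A. A \<in> F \<Longrightarrow> card {B \<in> F. A \<inter> B = {}} = d"
  shows "2 * card (edges (disjointness_graph F)) = card F * d"
    and "(\<And>A B C D. A \<in> F \<Longrightarrow> B \<in> F \<Longrightarrow> C \<in> F \<Longrightarrow> D \<in> F \<Longrightarrow> A \<inter> B = {} \<Longrightarrow> C \<inter> D = {} \<Longrightarrow>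
      within_two F A C \<or> within_two F A D \<or> within_two F B C \<or> within_two F B D) \<Longrightarrow>
      card (edges (disjointness_graph F)) + 1 \<le> h 3 d"
proof -
  let ?G = "disjointness_graph F"
  note G = fin_simple_disjointness_graph[OF F(1)]
  have V: "verts ?G = F" by (simp add: disjointness_graph_def)
  have deg: "degree ?G A = d" if "A \<in> F" for A
    using degree_disjointness_graph[OF F(2) that] reg[OF that] by simp
  then show "2 * card (edges ?G) = card F * d" using sum_degree[OF G] by (simp add: V)
  assume close: "\<And>A B C D. A \<in> F \<Longrightarrow> B \<in> F \<Longrightarrow> C \<in> F \<Longrightarrow> D \<in> F \<Longrightarrow> A \<inter> B = {} \<Longrightarrow> C \<inter> D = {} \<Longrightarrow>
      within_two F A C \<or> within_two F A D \<or> within_two F B C \<or> within_two F B D"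
  have "complete_graph (graph_power (line_graph ?G) 3)"
  proof (rule complete_line_cube[OF G])
    fix e f assume "e \<in> edges ?G" "f \<in> edges ?G"
    then obtain A B C D where AB: "e = {A, B}" "A \<in> F" "B \<in> F" "A \<inter> B = {}"
        and CD: "f = {C, D}" "C \<in> F" "D \<in> F" "C \<inter> D = {}"
      unfolding disjointness_graph_def by (simp, blast)
    obtain X Y where XY: "X \<in> e" "Y \<in> f" "within_two F X Y"
      using close[OF AB(2,3) CD(2,3) AB(4) CD(4)] unfolding AB(1) CD(1) by blast
    then have "X \<in> F" "Y \<in> F" using AB CD by blast+
    then have "X = Y \<or> {X, Y} \<in> edges ?G \<or> (\<exists>w. {X, w} \<in> edges ?G \<and> {w, Y} \<in> edges ?G)"
      using XY(3) unfolding within_two_def edges_disjointness_graph[OF F(2)] by metis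
    then show "\<exists>u \<in> e. \<exists>v \<in> f. u = v \<or> {u, v} \<in> edges ?G \<or>
        (\<exists>w. {u, w} \<in> edges ?G \<and> {w, v} \<in> edges ?G)"
      using XY(1,2) by blast
  qed
  then show "card (edges ?G) + 1 \<le> h 3 d"
    using deg by (intro card_edges_less_h[OF G]) (simp_all add: max_degree_le_iff[OF G] V)
qed

lemma card_Kneser_nbrs:
  assumes "finite S" "card S = n" "A \<subseteq> S" "card A = k"
  shows "card {B \<in> {B. B \<subseteq> S \<and> card B = m}. A \<inter> B = {}} = (n - k) choose m"
proof -
  have "{B \<in> {B. B \<subseteq> S \<and> card B = m}. A \<inter> B = {}} = {B. B \<subseteq> S - A \<and> card B = m}" by auto
  then show ?thesis using assms n_subsets[of "S - A" m]
    by (simp add: card_Diff_subset finite_subset)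
qed

section \<open>The Odd graph \<open>O\<^sub>4\<close>\<close>

text \<open>
  Two triples meeting in 2 points cover 4 of the 7 points and are both disjoint from the remaining triple. So triples at
  distance at least 3 meet in exactly one point. If \<open>A, B\<close> are disjoint, then a triple
  far from both contains the single point outside \<open>A \<union> B\<close>, and two disjoint triples cannot both do so.
\<close>

lemma odd_graph_4:
  "card (edges odd_graph_4) = 70" "card (edges odd_graph_4) + 1 \<le> h 3 4"
proof -
  define S where "S = {1..7::nat}"
  define F where "F = {A. A \<subseteq> S \<and> card A = 3}"
  have S: "finite S" "card S = 7" by (auto simp: S_def)
  have O4: "odd_graph_4 = disjointness_graph F"
    by (simp add: odd_graph_4_def kneser_graph_def F_def S_def)
  have fin: "finite A" if "A \<in> F" for A using that S by (auto simp: F_def intro: finite_subset)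
  have F: "finite F" "{} \<notin> F" using S by (auto simp: F_def)
  have reg: "card {B \<in> F. A \<inter> B = {}} = 4" if "A \<in> F" for A
    using card_Kneser_nbrs[OF S, of A 3 3] that unfolding F_def
    by (simp add: eval_nat_numeral)
  have cardF: "card F = 35"
    unfolding F_def n_subsets[OF S(1)] S(2) by (simp add: eval_nat_numeral)
  show "card (edges odd_graph_4) = 70"
    using regular_disjointness_graph(1)[OF F reg] cardF O4 by simp
  have one: "card (A \<inter> C) = 1"
    if AC: "A \<in> F" "C \<in> F" and nt: "\<not> within_two F A C" for A C
  proof -
    have far: "A \<noteq> C" "A \<inter> C \<noteq> {}" "\<not> (\<exists>Z \<in> F. A \<inter> Z = {} \<and> Z \<inter> C = {})"
      using nt unfolding within_two_def by blast+
    have fi: "finite A" "finite C" by (rule fin, rule AC)+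
    have f: "card A = 3" "card C = 3" "A \<subseteq> S" "C \<subseteq> S"
      using AC by (simp_all add: F_def)
    have "card (A \<inter> C) \<noteq> 0" using far(2) fi by simp
    moreover have "card (A \<inter> C) \<le> 3" using card_mono[of A "A \<inter> C"] f fi by simp
    moreover have "card (A \<inter> C) \<noteq> 3"
    proof
      assume c: "card (A \<inter> C) = 3"
      have "A \<inter> C = A" by (rule card_subset_eq) (use c f fi in auto)
      moreover have "A \<inter> C = C" by (rule card_subset_eq) (use c f fi in auto)
      ultimately show False using far(1) by simp
    qed
    moreover have "card (A \<inter> C) \<noteq> 2"
    proof
      assume "card (A \<inter> C) = 2"
      then have "card (A \<union> C) = 4" using card_Un_Int[OF fi] f by simp
      then have "card (S - (A \<union> C)) = 3" using f fi S by (simp add: card_Diff_subset)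
      then have "S - (A \<union> C) \<in> F" by (auto simp: F_def)
      moreover have "A \<inter> (S - (A \<union> C)) = {}" "(S - (A \<union> C)) \<inter> C = {}" by auto
      ultimately show False using far(3) by metis
    qed
    ultimately show ?thesis by linarith
  qed
  have "within_two F A C \<or> within_two F A D \<or> within_two F B C \<or> within_two F B D"
    if m: "A \<in> F" "B \<in> F" "C \<in> F" "D \<in> F" and disj: "A \<inter> B = {}" "C \<inter> D = {}" for A B C D
  proof (rule ccontr)
    assume "\<not> ?thesis"
    then have ones: "card (A \<inter> C) = 1" "card (B \<inter> C) = 1" "card (A \<inter> D) = 1" "card (B \<inter> D) = 1"
      using one m by simp_all
    have f: "finite A" "finite B" "finite C" "finite D" by (rule fin, rule m)+
    have sub: "A \<subseteq> S" "B \<subseteq> S" "card A = 3" "card B = 3" using m by (simp_all add: F_def)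
    define T where "T = S - (A \<union> B)"
    have "card (A \<union> B) = 6" using card_Un_disjoint[OF f(1,2) disj(1)] sub by simp
    then have T: "card T = 1" unfolding T_def using sub S f by (simp add: card_Diff_subset)
    have out: "card (K \<inter> T) = 1" if "K \<in> F" "card (A \<inter> K) = 1" "card (B \<inter> K) = 1" for K
    proof -
      have K: "finite K" "K \<subseteq> S" "card K = 3"
        using fin[OF that(1)] that(1) by (simp_all add: F_def)
      have "card ((A \<inter> K) \<union> (B \<inter> K)) = 2"
        using f disj(1) that card_Un_disjoint[of "A \<inter> K" "B \<inter> K"] by fastforce
      moreover have "K \<inter> T = K - ((A \<inter> K) \<union> (B \<inter> K))" using K by (auto simp: T_def)
      ultimately show ?thesis using K f by (simp add: card_Diff_subset)
    qed
    have "finite T" using S(1) by (simp add: T_def)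
    then have "C \<inter> T = T" "D \<inter> T = T"
      using out m ones T by (simp_all add: card_subset_eq)
    then have "T = {}" using disj(2) by blast
    then show False using T by simp
  qed
  then show "card (edges odd_graph_4) + 1 \<le> h 3 4"
    unfolding O4 by (intro regular_disjointness_graph(2)[OF F reg])
qed

section \<open>Octads of a Steiner system \<open>S(5,8,24)\<close> and the truncated Witt graph\<close>

text \<open>
  The pairs \<open>(S, C)\<close> with \<open>S \<subseteq> B \<inter> C\<close> and \<open>|S| = s\<close>, counted by \<open>C\<close> and by \<open>S\<close>.
\<close>

lemma sum_choose_inter:
  assumes F: "finite F" and B: "finite B"
    and r: "\<And>S. S \<subseteq> B \<Longrightarrow> card S = s \<Longrightarrow> card {C \<in> F. S \<subseteq> C} = r"
  shows "(\<Sum>C \<in> F. card (B \<inter> C) choose s) = r * (card B choose s)"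
proof -
  let ?Ss = "{S. S \<subseteq> B \<and> card S = s}"
  have sub: "card {S \<in> ?Ss. S \<subseteq> C} = card (B \<inter> C) choose s" for C
  proof -
    have "{S \<in> ?Ss. S \<subseteq> C} = {S. S \<subseteq> B \<inter> C \<and> card S = s}" by auto
    then show ?thesis using n_subsets[of "B \<inter> C" s] B by simp
  qed
  have "(\<Sum>C \<in> F. card {S \<in> ?Ss. S \<subseteq> C}) = r * card ?Ss"
    using F B r by (intro sum_multicount) auto
  then show ?thesis unfolding sub n_subsets[OF B] .
qed

lemma sum_by_inter_size:
  fixes g :: "nat \<Rightarrow> nat"
  assumes F: "finite F" and le: "\<And>C. C \<in> F \<Longrightarrow> card (B \<inter> C) \<le> m"
  shows "(\<Sum>C \<in> F. g (card (B \<inter> C))) = (\<Sum>i\<le>m. card {C \<in> F. card (B \<inter> C) = i} * g i)"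
proof -
  have "(\<Sum>C \<in> F. g (card (B \<inter> C))) =
      (\<Sum>i\<le>m. \<Sum>C \<in> {C \<in> F. card (B \<inter> C) = i}. g (card (B \<inter> C)))"
    using F le by (intro sum.group[symmetric]) auto
  also have "\<dots> = (\<Sum>i\<le>m. card {C \<in> F. card (B \<inter> C) = i} * g i)"
    by (intro sum.cong refl) simp
  finally show ?thesis .
qed

locale witt_design =
  fixes \<Omega> :: "'a set" and \<O> :: "'a set set"
  assumes steiner: "steiner_system 5 8 24 \<Omega> \<O>"
begin

lemma points: "finite \<Omega>" "card \<Omega> = 24"
  using steiner by (simp_all add: steiner_system_def)

lemma octadD:
  assumes "B \<in> \<O>"
  shows "B \<subseteq> \<Omega>" "card B = 8" "finite B"
proof -
  show B: "B \<subseteq> \<Omega>" "card B = 8" using steiner assms by (simp_all add: steiner_system_def)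
  show "finite B" using B(1) points(1) by (rule finite_subset)
qed

lemma finite_octads: "finite \<O>"
proof (rule finite_subset)
  show "\<O> \<subseteq> Pow \<Omega>" using octadD(1) by (auto simp only: Pow_iff)
  show "finite (Pow \<Omega>)" using points(1) by simp
qed

lemma ex1_octad:
  assumes "T \<subseteq> \<Omega>" "card T = 5"
  shows "\<exists>!B. B \<in> \<O> \<and> T \<subseteq> B"
  using steiner assms by (simp add: steiner_system_def)

lemma octad_eqI:
  assumes B: "B \<in> \<O>" and C: "C \<in> \<O>" and five: "5 \<le> card (B \<inter> C)"
  shows "B = C"
proof -
  obtain T where T: "T \<subseteq> B \<inter> C" "card T = 5"
    using obtain_subset_with_card_n[OF five] by metis
  then have sub: "T \<subseteq> B" "T \<subseteq> C" by simp_all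
  then have "T \<subseteq> \<Omega>" using octadD(1)[OF B] by simp
  then show ?thesis using ex1_octad[OF _ T(2)] B C sub by blast
qed

lemma card_inter_le:
  assumes "B \<in> \<O>" "C \<in> \<O>" "B \<noteq> C"
  shows "card (B \<inter> C) \<le> 4"
  using octad_eqI[OF assms(1,2)] assms(3) by linarith

definition through :: "'a set \<Rightarrow> nat" where
  "through S = card {B \<in> \<O>. S \<subseteq> B}"

lemma through_5:
  assumes "S \<subseteq> \<Omega>" "card S = 5"
  shows "through S = 1"
proof -
  obtain B where "B \<in> \<O> \<and> S \<subseteq> B" "\<And>C. C \<in> \<O> \<and> S \<subseteq> C \<Longrightarrow> C = B"
    using ex1_octad[OF assms] by (elim ex1E) blast
  then have "{B \<in> \<O>. S \<subseteq> B} = {B}" by blast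
  then show ?thesis by (simp add: through_def)
qed

text \<open>
  The pairs \<open>(x, B)\<close> of a point \<open>x\<close> outside \<open>S\<close> and an octad \<open>B\<close> containing \<open>S\<close> and \<open>x\<close>, counted
  in two ways.
\<close>

lemma through_step:
  assumes S: "S \<subseteq> \<Omega>"
    and r: "\<And>x. x \<in> \<Omega> - S \<Longrightarrow> through (insert x S) = r"
  shows "through S * (8 - card S) = r * (24 - card S)"
proof -
  let ?F = "{B \<in> \<O>. S \<subseteq> B}"
  have finS: "finite S" using S points(1) by (rule finite_subset)
  have "(\<Sum>B \<in> ?F. card {x \<in> \<Omega> - S. x \<in> B}) = r * card (\<Omega> - S)"
  proof (rule sum_multicount)
    show "\<forall>x \<in> \<Omega> - S. card {B \<in> ?F. x \<in> B} = r"
    proof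
      fix x assume "x \<in> \<Omega> - S"
      moreover have "{B \<in> ?F. x \<in> B} = {B \<in> \<O>. insert x S \<subseteq> B}" by auto
      ultimately show "card {B \<in> ?F. x \<in> B} = r" using r by (simp add: through_def)
    qed
  qed (use finite_octads points in simp_all)
  moreover have "card {x \<in> \<Omega> - S. x \<in> B} = 8 - card S" if "B \<in> ?F" for B
  proof -
    have B: "B \<in> \<O>" "S \<subseteq> B" using that by auto
    have "{x \<in> \<Omega> - S. x \<in> B} = B - S" using octadD(1)[OF B(1)] by auto
    then show ?thesis using B octadD[OF B(1)] finS by (simp add: card_Diff_subset)
  qed
  ultimately show ?thesis
    using card_Diff_subset[OF finS S] points by (simp add: through_def)
qed

lemma through_values:
  assumes S: "S \<subseteq> \<Omega>"
  shows "card S = 4 \<Longrightarrow> through S = 5"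
    and "card S = 3 \<Longrightarrow> through S = 21"
    and "card S = 2 \<Longrightarrow> through S = 77"
    and "card S = 1 \<Longrightarrow> through S = 253"
    and "card S = 0 \<Longrightarrow> through S = 759"
proof -
  have ins: "insert x S \<subseteq> \<Omega>" "card (insert x S) = Suc (card S)" if "x \<in> \<Omega> - S" "S \<subseteq> \<Omega>" for x S
    using that points(1) finite_subset[of S \<Omega>] by auto
  \<comment> \<open>Each value follows from the next larger size by one application of the double count.\<close>
  have four: "through S = 5" if "S \<subseteq> \<Omega>" "card S = 4" for S
    using through_step[OF that(1), of 1] through_5 ins[OF _ that(1)] that(2) by simp
  have three: "through S = 21" if "S \<subseteq> \<Omega>" "card S = 3" for S
    using through_step[OF that(1), of 5] four ins[OF _ that(1)] that(2) by simp
  have two: "through S = 77" if "S \<subseteq> \<Omega>" "card S = 2" for S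
    using through_step[OF that(1), of 21] three ins[OF _ that(1)] that(2) by simp
  have one: "through S = 253" if "S \<subseteq> \<Omega>" "card S = 1" for S
    using through_step[OF that(1), of 77] two ins[OF _ that(1)] that(2) by simp
  have zero: "through S = 759" if "S \<subseteq> \<Omega>" "card S = 0" for S
    using through_step[OF that(1), of 253] one ins[OF _ that(1)] that(2) by simp
  show "card S = 4 \<Longrightarrow> through S = 5" "card S = 3 \<Longrightarrow> through S = 21"
    "card S = 2 \<Longrightarrow> through S = 77" "card S = 1 \<Longrightarrow> through S = 253"
    "card S = 0 \<Longrightarrow> through S = 759"
    using S four three two one zero by simp_all
qed

definition others :: "'a \<Rightarrow> 'a set \<Rightarrow> 'a set set" where
  "others p B = {C \<in> \<O>. p \<notin> C \<and> C \<noteq> B}"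

lemma finite_others: "finite (others p B)"
  using finite_octads by (simp add: others_def)

lemma card_others_through:
  assumes B: "B \<in> \<O>" and S: "S \<subseteq> B" and p: "p \<notin> B"
  shows "card {C \<in> others p B. S \<subseteq> C} + through (insert p S) + 1 = through S"
proof -
  let ?X = "{C \<in> others p B. S \<subseteq> C}" and ?Y = "{C \<in> \<O>. insert p S \<subseteq> C}"
  have fin: "finite ?X" "finite ?Y" using finite_octads by (simp_all add: others_def)
  have "{C \<in> \<O>. S \<subseteq> C} = insert B (?X \<union> ?Y)"
    using B S by (auto simp: others_def)
  moreover have "B \<notin> ?X \<union> ?Y" using p by (auto simp: others_def)
  moreover have "card (?X \<union> ?Y) = card ?X + card ?Y"
    using fin by (intro card_Un_disjoint) (auto simp: others_def)
  ultimately show ?thesis using fin by (simp add: through_def)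
qed

text \<open>
  With \<open>n i\<close> the number of octads \<open>C \<noteq> B\<close> that avoid \<open>p\<close> and meet \<open>B\<close> in \<open>i\<close> points, the number of
  such octads through a given \<open>s\<close>-subset of \<open>B\<close> is \<open>\<lambda>\<^sub>s - \<lambda>\<^sub>s\<^sub>+\<^sub>1 - 1\<close>, where \<open>\<lambda>\<^sub>i\<close> counts the
  octads through \<open>i\<close> points. For \<open>s = 0,...,4\<close> this gives five
  linear equations, triangular in the five unknowns. Working with the octads that avoid \<open>p\<close> yields the valency of
  the truncated Witt graph and the absence of odd intersections from one computation.
\<close>

lemma others_profile:
  assumes B: "B \<in> \<O>" and p: "p \<in> \<Omega>" "p \<notin> B"
  shows "card {C \<in> others p B. card (B \<inter> C) = 0} = 15"
    and "card {C \<in> others p B. card (B \<inter> C) = 1} = 0"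
    and "card {C \<in> others p B. card (B \<inter> C) = 3} = 0"
proof -
  note oB = octadD[OF B]
  define n where "n i = card {C \<in> others p B. card (B \<inter> C) = i}" for i
  have le: "card (B \<inter> C) \<le> 4" if "C \<in> others p B" for C
    using that card_inter_le[OF B, of C] by (auto simp: others_def)
  have eq: "(\<Sum>i\<le>4. n i * (i choose s)) = r * (8 choose s)"
    if "\<And>S. S \<subseteq> B \<Longrightarrow> card S = s \<Longrightarrow> card {C \<in> others p B. S \<subseteq> C} = r" for s r
    using sum_choose_inter[OF finite_others oB(3) that]
      sum_by_inter_size[of "others p B" B 4 "\<lambda>i. i choose s", OF finite_others le] oB(2)
    by (simp add: n_def)
  have cnt: "S \<subseteq> \<Omega>" "insert p S \<subseteq> \<Omega>" "card (insert p S) = Suc (card S)"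
    "card {C \<in> others p B. S \<subseteq> C} + through (insert p S) + 1 = through S" if "S \<subseteq> B" for S
  proof -
    have "p \<notin> S" using that p by blast
    then show "S \<subseteq> \<Omega>" "insert p S \<subseteq> \<Omega>" "card (insert p S) = Suc (card S)"
      using that p oB(1) finite_subset[OF that oB(3)] by auto
    show "card {C \<in> others p B. S \<subseteq> C} + through (insert p S) + 1 = through S"
      by (rule card_others_through[OF B that p(2)])
  qed
  have r4: "card {C \<in> others p B. S \<subseteq> C} = 3" if "S \<subseteq> B" "card S = 4" for S
    using cnt[OF that(1)] that(2) through_values[of S] through_5[of "insert p S"] by simp
  have r3: "card {C \<in> others p B. S \<subseteq> C} = 15" if "S \<subseteq> B" "card S = 3" for S
    using cnt[OF that(1)] that(2) through_values[of S] through_values[of "insert p S"] by simp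
  have r2: "card {C \<in> others p B. S \<subseteq> C} = 55" if "S \<subseteq> B" "card S = 2" for S
    using cnt[OF that(1)] that(2) through_values[of S] through_values[of "insert p S"] by simp
  have r1: "card {C \<in> others p B. S \<subseteq> C} = 175" if "S \<subseteq> B" "card S = 1" for S
    using cnt[OF that(1)] that(2) through_values[of S] through_values[of "insert p S"] by simp
  have r0: "card {C \<in> others p B. S \<subseteq> C} = 505" if "S \<subseteq> B" "card S = 0" for S
    using cnt[OF that(1)] that(2) through_values[of S] through_values[of "insert p S"] by simp
  have choose: "(4::nat) choose 2 = 6" "(4::nat) choose 3 = 4" "(3::nat) choose 2 = 3"
    "(8::nat) choose 2 = 28" "(8::nat) choose 3 = 56" "(8::nat) choose 4 = 70"
    by (simp_all add: eval_nat_numeral)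
  have S5: "(\<Sum>i\<le>4. f i) = f 0 + f 1 + f 2 + f 3 + f 4" for f :: "nat \<Rightarrow> nat"
    by (simp add: eval_nat_numeral)
  have e4: "n 4 = 210" using eq[of 4 3, OF r4] by (simp add: S5 choose binomial_eq_0)
  have e3: "n 3 + 4 * n 4 = 840" using eq[of 3 15, OF r3] by (simp add: S5 choose binomial_eq_0)
  have e2: "n 2 + 3 * n 3 + 6 * n 4 = 1540" using eq[of 2 55, OF r2] by (simp add: S5 choose binomial_eq_0)
  have e1: "n 1 + 2 * n 2 + 3 * n 3 + 4 * n 4 = 1400" using eq[of 1 175, OF r1] by (simp add: S5 choose binomial_eq_0)
  have e0: "n 0 + n 1 + n 2 + n 3 + n 4 = 505" using eq[of 0 505, OF r0] by (simp add: S5 choose binomial_eq_0)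
  have "n 0 = 15" "n 1 = 0" "n 3 = 0" using e0 e1 e2 e3 e4 by linarith+
  then show "card {C \<in> others p B. card (B \<inter> C) = 0} = 15"
    "card {C \<in> others p B. card (B \<inter> C) = 1} = 0"
    "card {C \<in> others p B. card (B \<inter> C) = 3} = 0"
    by (simp_all only: n_def)
qed

text \<open>
  Two octads cover at most 16 points, so some point avoids both, and the profile with
  respect to that point applies.
\<close>

lemma even_inter:
  assumes B: "B \<in> \<O>" and C: "C \<in> \<O>"
  shows "even (card (B \<inter> C))"
proof (cases "B = C")
  case False
  have "card (B \<union> C) \<le> 16" using card_Un_le[of B C] octadD[OF B] octadD[OF C] by simp
  then have "B \<union> C \<noteq> \<Omega>" using points(2) by auto
  then obtain p where p: "p \<in> \<Omega>" "p \<notin> B" "p \<notin> C"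
    using octadD(1)[OF B] octadD(1)[OF C] by blast
  have mem: "C \<in> others p B" using False C p by (simp add: others_def)
  have "card (B \<inter> C) \<noteq> i" if "card {C \<in> others p B. card (B \<inter> C) = i} = 0" for i
    using that mem finite_others[of p B] by auto
  then have "card (B \<inter> C) \<noteq> 1" "card (B \<inter> C) \<noteq> 3"
    using others_profile[OF B p(1,2)] by blast+
  with card_inter_le[OF B C False] show ?thesis by presburger
qed (simp add: octadD(2)[OF C])

text \<open>
  Count the 56 five-subsets of \<open>T\<close> by the unique octad containing them. An octad meeting \<open>T\<close> evenly but
  different from \<open>T\<close> contains none of them or, if it meets \<open>T\<close> in 6 points, exactly 6; but 6 does not
  divide 56.
\<close>

lemma octad_if_even:
  assumes T: "T \<subseteq> \<Omega>" "card T = 8" and even: "\<And>D. D \<in> \<O> \<Longrightarrow> even (card (T \<inter> D))"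
  shows "T \<in> \<O>"
proof (rule ccontr)
  assume notin: "T \<notin> \<O>"
  have finT: "finite T" using T(1) points(1) by (rule finite_subset)
  have "card {C \<in> \<O>. S \<subseteq> C} = 1" if "S \<subseteq> T" "card S = 5" for S
    using through_5[of S] that T(1) by (simp add: through_def)
  then have "(\<Sum>D \<in> \<O>. card (T \<inter> D) choose 5) = 56"
    using sum_choose_inter[OF finite_octads finT, of 5 1] T(2) by (simp add: eval_nat_numeral)
  moreover have "6 dvd (card (T \<inter> D) choose 5)" if D: "D \<in> \<O>" for D
  proof -
    have "card (T \<inter> D) \<noteq> 8"
    proof
      assume c: "card (T \<inter> D) = 8"
      have "T \<inter> D = T" using c T(2) finT by (intro card_subset_eq) auto
      moreover have "T \<inter> D = D" using c octadD[OF D] by (intro card_subset_eq) auto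
      ultimately show False using notin D by simp
    qed
    moreover have "card (T \<inter> D) \<le> 8" using card_mono[OF finT, of "T \<inter> D"] T(2) by simp
    ultimately have "card (T \<inter> D) < 5 \<or> card (T \<inter> D) = 6" using even[OF D] by presburger
    then show ?thesis
    proof
      assume "card (T \<inter> D) < 5"
      then show ?thesis by (simp add: binomial_eq_0)
    qed (simp add: eval_nat_numeral)
  qed
  then have "6 dvd (\<Sum>D \<in> \<O>. card (T \<inter> D) choose 5)" by (rule dvd_sum)
  ultimately show False by simp
qed

text \<open>
  Let \<open>P\<close> be the octad through \<open>p\<close> and the four points \<open>X = A \<inter> C\<close>. The octads \<open>A\<close>, \<open>C\<close>,
  \<open>P\<close> meet pairwise in \<open>X\<close>, so \<open>A \<union> C \<union> P\<close> is, modulo 2, their sum. Its complement thus has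
  8 points and meets every octad evenly; it is an octad, disjoint from \<open>A\<close> and \<open>C\<close>, and \<open>p\<close>
  is not in it.
\<close>

lemma common_nbr_of_tetrad:
  assumes A: "A \<in> \<O>" and C: "C \<in> \<O>" and four: "card (A \<inter> C) = 4"
    and p: "p \<in> \<Omega>" "p \<notin> A" "p \<notin> C"
  shows "\<exists>E \<in> \<O>. p \<notin> E \<and> A \<inter> E = {} \<and> E \<inter> C = {}"
proof -
  note oA = octadD[OF A] and oC = octadD[OF C]
  define X where "X = A \<inter> C"
  have X: "finite X" "card X = 4" using oA four by (simp_all add: X_def)
  have "insert p X \<subseteq> \<Omega>" "card (insert p X) = 5" using X p oA by (auto simp: X_def)
  then obtain P where P: "P \<in> \<O>" "insert p X \<subseteq> P" using ex1_octad by blast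
  note oP = octadD[OF P(1)]
  have meet: "K \<inter> P = X" if K: "K \<in> \<O>" "p \<notin> K" "X \<subseteq> K" for K
  proof -
    have "X \<subseteq> K \<inter> P" using K P(2) by auto
    moreover have "K \<noteq> P" using K(2) P(2) by auto
    then have "card (K \<inter> P) \<le> card X" using card_inter_le[OF K(1) P(1)] X(2) by simp
    ultimately show ?thesis using card_seteq[of "K \<inter> P" X] oP(3) by auto
  qed
  have AP: "A \<inter> P = X" by (rule meet[OF A p(2)]) (simp add: X_def)
  have CP: "C \<inter> P = X" by (rule meet[OF C p(3)]) (simp add: X_def)
  define U where "U = A \<union> C \<union> P"
  define E where "E = \<Omega> - U"
  have U: "U \<subseteq> \<Omega>" using oA oC oP by (simp add: U_def)
  have finU: "finite U" using U points(1) by (rule finite_subset)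
  have count: "card (D \<inter> U) + 2 * card (D \<inter> X) = card (D \<inter> A) + card (D \<inter> C) + card (D \<inter> P)" for D
  proof -
    have "(D \<inter> A) \<inter> (D \<inter> C) = D \<inter> X" by (auto simp: X_def)
    then have 1: "card (D \<inter> A) + card (D \<inter> C) = card ((D \<inter> A) \<union> (D \<inter> C)) + card (D \<inter> X)"
      using card_Un_Int[of "D \<inter> A" "D \<inter> C"] oA oC by simp
    have "((D \<inter> A) \<union> (D \<inter> C)) \<inter> (D \<inter> P) = D \<inter> X" using AP CP by blast
    moreover have "((D \<inter> A) \<union> (D \<inter> C)) \<union> (D \<inter> P) = D \<inter> U" by (auto simp: U_def)
    ultimately have "card ((D \<inter> A) \<union> (D \<inter> C)) + card (D \<inter> P) = card (D \<inter> U) + card (D \<inter> X)"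
      using card_Un_Int[of "(D \<inter> A) \<union> (D \<inter> C)" "D \<inter> P"] oA oC oP by simp
    with 1 show ?thesis by simp
  qed
  have "U \<inter> U = U" "U \<inter> X = X" "U \<inter> A = A" "U \<inter> C = C" "U \<inter> P = P" by (auto simp: U_def X_def)
  then have "card U = 16" using count[of U] X(2) oA(2) oC(2) oP(2) by simp
  then have cardE: "card E = 8" using card_Diff_subset[OF finU U] points(2) by (simp add: E_def)
  have "E \<in> \<O>"
  proof (rule octad_if_even[OF _ cardE])
    show "E \<subseteq> \<Omega>" by (auto simp: E_def)
    fix D assume D: "D \<in> \<O>"
    have "E \<inter> D = D - (D \<inter> U)" using octadD(1)[OF D] by (auto simp: E_def)
    then have "card (E \<inter> D) + card (D \<inter> U) = 8"
      using card_Diff_subset[of "D \<inter> U" D] octadD[OF D] card_mono[of D "D \<inter> U"] by simp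
    moreover have "even (card (D \<inter> U))"
      using count[of D] even_inter[OF D A] even_inter[OF D C] even_inter[OF D P(1)] by presburger
    ultimately show "even (card (E \<inter> D))" by presburger
  qed
  moreover have "p \<notin> E" using P(2) by (auto simp: E_def U_def)
  moreover have "A \<inter> E = {}" "E \<inter> C = {}" by (auto simp: E_def U_def)
  ultimately show ?thesis by blast
qed

text \<open>
  Distinct octads that avoid \<open>p\<close> are at distance at most 2 if they meet in 0 or 4 points,
  so distance at least 3 means meeting in 2 points. If \<open>A, B\<close> are disjoint, an octad meeting
  both in 2 points has 4 points in \<open>T\<close>, the complement of \<open>A \<union> B\<close>. Two disjoint such octads would cover
  all 8 points of \<open>T\<close>, among them \<open>p\<close>.
\<close>

lemma truncated_witt:
  assumes p: "p \<in> \<Omega>"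
  shows "card (edges (truncated_witt_graph \<O> p)) = 3795"
    and "card (edges (truncated_witt_graph \<O> p)) + 1 \<le> h 3 15"
proof -
  define F where "F = {B \<in> \<O>. p \<notin> B}"
  have W: "truncated_witt_graph \<O> p = disjointness_graph F"
    by (simp add: truncated_witt_graph_def F_def)
  have FD: "A \<in> \<O>" "p \<notin> A" if "A \<in> F" for A using that by (simp_all add: F_def)
  have finF: "finite F" using finite_octads by (simp add: F_def)
  have emp: "{} \<notin> F" using octadD(2)[of "{}"] by (auto simp: F_def)
  have "\<O> = F \<union> {B \<in> \<O>. {p} \<subseteq> B}" by (auto simp: F_def)
  then have "card \<O> = card F + through {p}"
    unfolding through_def using finite_octads
    by (metis (no_types, lifting) F_def card_Un_disjoint disjoint_iff finite_Un insert_subset mem_Collect_eq)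
  moreover have "card \<O> = 759" using through_values(5)[of "{}"] by (simp add: through_def)
  moreover have "through {p} = 253" using through_values(4)[of "{p}"] p by simp
  ultimately have cardF: "card F = 506" by simp
  have reg: "card {C \<in> F. B \<inter> C = {}} = 15" if B: "B \<in> F" for B
  proof -
    note oB = octadD[OF FD(1)[OF B]]
    have "{C \<in> F. B \<inter> C = {}} = {C \<in> others p B. card (B \<inter> C) = 0}"
      using oB by (auto simp: F_def others_def)
    then show ?thesis using others_profile(1)[OF FD(1)[OF B] p FD(2)[OF B]] by simp
  qed
  show "card (edges (truncated_witt_graph \<O> p)) = 3795"
    using regular_disjointness_graph(1)[OF finF emp reg] cardF W by simp
  have two: "card (A \<inter> C) = 2" if A: "A \<in> F" and C: "C \<in> F" and far: "\<not> within_two F A C" for A C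
  proof -
    have "A \<noteq> C" "A \<inter> C \<noteq> {}" "\<not> (\<exists>Z \<in> F. A \<inter> Z = {} \<and> Z \<inter> C = {})"
      using far unfolding within_two_def by blast+
    then have "card (A \<inter> C) \<noteq> 4"
      using common_nbr_of_tetrad[OF FD(1)[OF A] FD(1)[OF C] _ p FD(2)[OF A] FD(2)[OF C]]
      unfolding F_def by blast
    moreover have "card (A \<inter> C) \<noteq> 0"
      using \<open>A \<inter> C \<noteq> {}\<close> octadD(3)[OF FD(1)[OF A]] by simp
    ultimately show ?thesis
      using card_inter_le[OF FD(1)[OF A] FD(1)[OF C] \<open>A \<noteq> C\<close>]
        even_inter[OF FD(1)[OF A] FD(1)[OF C]] by presburger
  qed
  have "within_two F A C \<or> within_two F A D \<or> within_two F B C \<or> within_two F B D"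
    if m: "A \<in> F" "B \<in> F" "C \<in> F" "D \<in> F" and disj: "A \<inter> B = {}" "C \<inter> D = {}" for A B C D
  proof (rule ccontr)
    assume "\<not> ?thesis"
    then have twos: "card (A \<inter> C) = 2" "card (B \<inter> C) = 2" "card (A \<inter> D) = 2" "card (B \<inter> D) = 2"
      using two m by simp_all
    note oA = octadD[OF FD(1)[OF m(1)]] and oB = octadD[OF FD(1)[OF m(2)]]
    define T where "T = \<Omega> - (A \<union> B)"
    have finT: "finite T" using points(1) by (simp add: T_def)
    have "card (A \<union> B) = 16" using card_Un_disjoint[OF oA(3) oB(3) disj(1)] oA(2) oB(2) by simp
    then have T: "card T = 8"
      using card_Diff_subset[of "A \<union> B" \<Omega>] oA oB points(2) by (simp add: T_def)
    have "p \<in> T" using p FD(2) m by (simp add: T_def)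
    then have Tp: "card (T - {p}) = 7" using T finT by simp
    have out: "card (K \<inter> T) = 4 \<and> K \<inter> T \<subseteq> T - {p}"
      if K: "K \<in> F" "card (A \<inter> K) = 2" "card (B \<inter> K) = 2" for K
    proof -
      note oK = octadD[OF FD(1)[OF K(1)]]
      have fin: "finite (A \<inter> K)" "finite (B \<inter> K)" using oK by simp_all
      have "(A \<inter> K) \<inter> (B \<inter> K) = {}" using disj(1) by blast
      then have "card ((A \<inter> K) \<union> (B \<inter> K)) = 4"
        using card_Un_disjoint[OF fin] K by simp
      moreover have "K \<inter> T = K - ((A \<inter> K) \<union> (B \<inter> K))" using oK(1) by (auto simp: T_def)
      ultimately have "card (K \<inter> T) = 4"
        using card_Diff_subset[of "(A \<inter> K) \<union> (B \<inter> K)" K] fin oK(2) by simp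
      then show ?thesis using FD(2)[OF K(1)] by blast
    qed
    have C: "card (C \<inter> T) = 4" "C \<inter> T \<subseteq> T - {p}" using out m(3) twos(1,2) by simp_all
    have D: "card (D \<inter> T) = 4" "D \<inter> T \<subseteq> T - {p}" using out m(4) twos(3,4) by simp_all
    have "(C \<inter> T) \<inter> (D \<inter> T) = {}" using disj(2) by blast
    then have "card ((C \<inter> T) \<union> (D \<inter> T)) = 8"
      using card_Un_disjoint[of "C \<inter> T" "D \<inter> T"] C(1) D(1) finT by simp
    moreover have "card ((C \<inter> T) \<union> (D \<inter> T)) \<le> card (T - {p})"
      using C(2) D(2) finT by (intro card_mono) auto
    ultimately show False using Tp by simp
  qed
  then show "card (edges (truncated_witt_graph \<O> p)) + 1 \<le> h 3 15"
    unfolding W by (intro regular_disjointness_graph(2)[OF finF emp reg])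
qed

end

section \<open>Steiner systems from codes with the parameters of the Golay code\<close>

lemma card_sym_diff:
  assumes "finite A" "finite B"
  shows "card (sym_diff A B) + 2 * card (A \<inter> B) = card A + card B"
proof -
  have "card (sym_diff A B) = card (A - B) + card (B - A)"
    using assms by (intro card_Un_disjoint) auto
  moreover have "card A = card (A - B) + card (A \<inter> B)"
    using assms by (metis add.commute card_Int_Diff)
  moreover have "card B = card (B - A) + card (A \<inter> B)"
    using assms by (metis add.commute card_Int_Diff Int_commute)
  ultimately show ?thesis by simp
qed

text \<open>
  A set \<open>T\<close> of odd size is determined by \<open>T - {x}\<close>, which can be any subset of \<open>S - {x}\<close>: its parity
  tells whether \<open>x \<in> T\<close>.
\<close>

lemma card_odd_subsets:
  assumes "finite S" "x \<in> S"
  shows "card {T. T \<subseteq> S \<and> odd (card T)} = 2 ^ (card S - 1)"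
proof -
  let ?f = "\<lambda>T. if odd (card T) then T else insert x T"
  have "bij_betw ?f (Pow (S - {x})) {T. T \<subseteq> S \<and> odd (card T)}"
  proof (rule bij_betwI[where g = "\<lambda>T. T - {x}"])
    have fin: "finite T" if "T \<subseteq> S" for T using that assms(1) finite_subset by blast
    show "?f \<in> Pow (S - {x}) \<rightarrow> {T. T \<subseteq> S \<and> odd (card T)}"
    proof
      fix T assume T: "T \<in> Pow (S - {x})"
      then have "finite T" "x \<notin> T" using fin[of T] by auto
      then show "?f T \<in> {T. T \<subseteq> S \<and> odd (card T)}" using T assms(2) by auto
    qed
    show "(\<lambda>T. T - {x}) \<in> {T. T \<subseteq> S \<and> odd (card T)} \<rightarrow> Pow (S - {x})" by auto
    show "?f T - {x} = T" if "T \<in> Pow (S - {x})" for T using that by auto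
    fix T assume T: "T \<in> {T. T \<subseteq> S \<and> odd (card T)}"
    show "?f (T - {x}) = T"
    proof (cases "x \<in> T")
      case True
      then have "card T = Suc (card (T - {x}))" using T fin card.remove[of T x] by blast
      then show ?thesis using T True by auto
    qed (use T in auto)
  qed
  then have "card {T. T \<subseteq> S \<and> odd (card T)} = card (Pow (S - {x}))"
    by (simp add: bij_betw_same_card)
  then show ?thesis using assms by (simp add: card_Pow)
qed

text \<open>
  A perfect code argument. The cosets \<open>V + C\<close> with \<open>|V| = 1\<close> or \<open>|V| = 3\<close> are pairwise disjoint because two such \<open>V\<close>
  differ in at most 6 points. They number \<open>24 + 2024 = 2\<^sup>1\<^sup>1\<close>, with \<open>2\<^sup>1\<^sup>2\<close> elements each, and
  hence fill the \<open>2\<^sup>2\<^sup>3\<close> sets of odd size. So a 5-set \<open>T\<close> differs from some word \<open>c\<close> by such a \<open>V\<close>; as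
  \<open>c\<close> has at least 8 points, \<open>V\<close> has 3 points, is disjoint from \<open>T\<close>, and \<open>c = T \<union> V\<close> is an octad.
\<close>

lemma steiner_system_of_code:
  fixes \<Omega> :: "'a set" and C :: "'a set set"
  assumes \<Omega>: "finite \<Omega>" "card \<Omega> = 24"
    and C: "C \<subseteq> Pow \<Omega>" "card C = 2 ^ 12"
    and lin: "\<And>c d. c \<in> C \<Longrightarrow> d \<in> C \<Longrightarrow> sym_diff c d \<in> C"
    and even: "\<And>c. c \<in> C \<Longrightarrow> even (card c)"
    and dist: "\<And>c. c \<in> C \<Longrightarrow> c \<noteq> {} \<Longrightarrow> 8 \<le> card c"
  shows "steiner_system 5 8 24 \<Omega> {c \<in> C. card c = 8}"
proof -
  have fin: "finite T" if "T \<subseteq> \<Omega>" for T using that \<Omega>(1) finite_subset by blast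
  define E where "E = {V. V \<subseteq> \<Omega> \<and> card V = 1} \<union> {V. V \<subseteq> \<Omega> \<and> card V = 3}"
  define odds where "odds = {T. T \<subseteq> \<Omega> \<and> odd (card T)}"
  have finE: "finite E" unfolding E_def using \<Omega>(1)
    by (auto intro: finite_subset[of _ "Pow \<Omega>"])
  have "card E = card {V. V \<subseteq> \<Omega> \<and> card V = 1} + card {V. V \<subseteq> \<Omega> \<and> card V = 3}"
    unfolding E_def using \<Omega>(1) by (intro card_Un_disjoint) (auto intro: finite_subset[of _ "Pow \<Omega>"])
  also have "\<dots> = 2 ^ 11"
    unfolding n_subsets[OF \<Omega>(1)] \<Omega>(2) by (simp add: binomial_fact' fact_numeral)
  finally have cardE: "card E = 2 ^ 11" .
  obtain p where "p \<in> \<Omega>" using \<Omega> by fastforce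
  then have cardO: "card odds = 2 ^ 23"
    unfolding odds_def using card_odd_subsets[OF \<Omega>(1)] \<Omega>(2) by simp
  have inj: "inj_on (\<lambda>(V, c). sym_diff V c) (E \<times> C)"
  proof (clarify intro!: inj_onI)
    fix V c V' c' assume *: "V \<in> E" "c \<in> C" "V' \<in> E" "c' \<in> C" "sym_diff V c = sym_diff V' c'"
    have V: "finite V" "finite V'" "card V \<le> 3" "card V' \<le> 3"
      using * fin by (auto simp: E_def)
    have eq: "sym_diff V V' = sym_diff c c'" using *(5) by blast
    have "card (sym_diff V V') \<le> 6" using card_sym_diff[of V V'] V by linarith
    then have "sym_diff c c' = {}" using lin[OF *(2,4)] dist eq by fastforce
    then show "V = V' \<and> c = c'" using eq by blast
  qed
  have "(\<lambda>(V, c). sym_diff V c) ` (E \<times> C) = odds"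
  proof (rule card_subset_eq)
    show "finite odds" unfolding odds_def using \<Omega>(1) by simp
    show "(\<lambda>(V, c). sym_diff V c) ` (E \<times> C) \<subseteq> odds"
    proof clarify
      fix V c assume *: "V \<in> E" "c \<in> C"
      then have sub: "V \<subseteq> \<Omega>" "c \<subseteq> \<Omega>" and "odd (card V)" "even (card c)"
        using C even by (auto simp: E_def)
      then have "odd (card (sym_diff V c))"
        using card_sym_diff[OF fin fin, of V c] by presburger
      then show "sym_diff V c \<in> odds" unfolding odds_def using sub by blast
    qed
    show "card ((\<lambda>(V, c). sym_diff V c) ` (E \<times> C)) = card odds"
      unfolding card_image[OF inj] by (simp add: card_cartesian_product cardE C cardO)
  qed
  note cover = this
  have ex: "\<exists>c. c \<in> C \<and> card c = 8 \<and> T \<subseteq> c" if T: "T \<subseteq> \<Omega>" "card T = 5" for T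
  proof -
    have "T \<in> odds" using T by (simp add: odds_def)
    then obtain V c where Vc: "V \<in> E" "c \<in> C" "T = sym_diff V c" using cover by blast
    have c: "c = sym_diff T V" using Vc(3) by blast
    have V: "finite V" "card V \<le> 3" using Vc fin by (auto simp: E_def)
    have "c \<noteq> {}" using c V T(2) by auto
    then have "8 \<le> card c" using dist Vc by blast
    moreover have eq: "card c + 2 * card (T \<inter> V) = 5 + card V"
      using card_sym_diff[of T V] fin T V c by simp
    ultimately have "card (T \<inter> V) = 0" "card c = 8" using V by linarith+
    then have "T \<inter> V = {}" using V by simp
    then show ?thesis using c Vc \<open>card c = 8\<close> by blast
  qed
  have uniq: "c = d" if "c \<in> C" "d \<in> C" "card c = 8" "card d = 8" "T \<subseteq> c" "T \<subseteq> d" "card T = 5"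
    for T c d
  proof -
    have f: "finite c" "finite d" using that C fin by auto
    have "5 \<le> card (c \<inter> d)" using that f by (metis card_mono finite_Int le_inf_iff)
    then have "card (sym_diff c d) \<le> 6" using card_sym_diff[OF f] that by linarith
    then have "sym_diff c d = {}" using dist[OF lin[OF that(1,2)]] by fastforce
    then show ?thesis by blast
  qed
  show ?thesis unfolding steiner_system_def
  proof (intro conjI allI impI ballI)
    fix T assume T: "T \<subseteq> \<Omega> \<and> card T = 5"
    then obtain c where "c \<in> C" "card c = 8" "T \<subseteq> c" using ex by blast
    then show "\<exists>!B. B \<in> {c \<in> C. card c = 8} \<and> T \<subseteq> B"
      using T uniq by (intro ex1I[of _ c]) auto
  qed (use \<Omega> C in auto)
qed

section \<open>The extended Golay code by Turyn's construction\<close>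

text \<open>
  The lines of the Fano plane on the residues modulo 7, translates of the quadratic residues
  \<open>{1, 2, 4}\<close>, each extended by the extra point 7. Below, \<open>fano_neg\<close> is the image under
  \<open>i \<mapsto> -i\<close>, that is, the same construction from the non-residues.
\<close>

definition fano :: "nat list list" where
  "fano = [[1,2,4,7],[2,3,5,7],[3,4,6,7],[0,4,5,7],[1,5,6,7],[0,2,6,7],[0,1,3,7]]"

definition fano_neg :: "nat list list" where
  "fano_neg = [[3,5,6,7],[2,4,5,7],[1,3,4,7],[0,2,3,7],[1,2,6,7],[0,1,5,7],[0,4,6,7]]"

text \<open>
  The dual code of the span of \<open>Ks\<close>. For the two extended Fano planes it is an \<open>[8,4,4]\<close> extended Hamming
  code, which is its own dual.
\<close>

definition even_on :: "nat list list \<Rightarrow> nat set set" where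
  "even_on Ks = {A. A \<subseteq> {..<8} \<and> (\<forall>K \<in> set Ks. even (card (A \<inter> set K)))}"

text \<open>
  Executable listing of \<open>even_on Ks\<close>, through which the finitely many facts needed about the two Hamming
  codes are computed.
\<close>

definition even_lists :: "nat list list \<Rightarrow> nat list list" where
  "even_lists Ks =
     filter (\<lambda>xs. list_all (\<lambda>K. even (length (filter (\<lambda>i. i \<in> set K) xs))) Ks) (subseqs [0..<8])"

lemma even_lists:
  shows "even_on Ks = set ` set (even_lists Ks)" (is ?image)
    and "inj_on set (set (even_lists Ks))" (is ?inj)
    and "distinct (even_lists Ks)" (is ?dist)
    and "\<And>xs. xs \<in> set (even_lists Ks) \<Longrightarrow> card (set xs) = length xs"
proof -
  define ps where "ps = [0..<8::nat]"
  have ps: "distinct ps" "set ps = {..<8}"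
    unfolding ps_def by (simp_all add: lessThan_atLeast0)
  have pow: "set ` set (subseqs ps) = Pow {..<8}"
    using subseqs_powset[of ps] ps by simp
  have sub: "distinct xs \<and> set xs \<subseteq> {..<8}" if "xs \<in> set (subseqs ps)" for xs
    using that pow subseqs_distinctD[OF that ps(1)] by blast
  have len: "length (filter (\<lambda>i. i \<in> set K) xs) = card (set xs \<inter> set K)"
    if "xs \<in> set (subseqs ps)" for xs K
  proof -
    have "distinct (filter (\<lambda>i. i \<in> set K) xs)" using sub[OF that] by simp
    then have "length (filter (\<lambda>i. i \<in> set K) xs) = card (set (filter (\<lambda>i. i \<in> set K) xs))"
      by (metis distinct_card)
    also have "set (filter (\<lambda>i. i \<in> set K) xs) = set xs \<inter> set K" by auto
    finally show ?thesis .
  qed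
  have evens: "even_lists Ks = filter (\<lambda>xs. \<forall>K \<in> set Ks. even (card (set xs \<inter> set K))) (subseqs ps)"
    unfolding even_lists_def ps_def[symmetric] list_all_iff using len by (intro filter_cong) auto
  show ?image
  proof (intro set_eqI iffI)
    fix A assume A: "A \<in> even_on Ks"
    then have "A \<in> set ` set (subseqs ps)" unfolding pow by (simp add: even_on_def)
    then show "A \<in> set ` set (even_lists Ks)"
      using A unfolding evens by (auto simp: even_on_def)
  next
    fix A assume "A \<in> set ` set (even_lists Ks)"
    then show "A \<in> even_on Ks"
      using sub unfolding evens by (auto simp: even_on_def)
  qed
  have d: "distinct (map set (subseqs ps))" by (rule distinct_set_subseqs) (rule ps)
  then show ?inj unfolding distinct_map evens by (auto intro: inj_on_subset)
  show ?dist using d unfolding distinct_map evens by simp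
  show "card (set xs) = length xs" if "xs \<in> set (even_lists Ks)" for xs
    using that sub distinct_card unfolding evens by auto
qed

text \<open>
  Both codes have 16 words, with weights 0, 4 and 8. The last computation says that
  they share only words of weight divisible by 8, that is, the empty and the full set.
\<close>

lemma even_lists_fano:
  "list_all (\<lambda>xs. length xs mod 4 = 0) (even_lists fano)" "length (even_lists fano) = 16"
  "list_all (\<lambda>xs. length xs mod 4 = 0) (even_lists fano_neg)" "length (even_lists fano_neg) = 16"
  "list_all (\<lambda>xs. length xs mod 8 = 0) (even_lists (fano @ fano_neg))"
  by code_simp+

lemma card_even_on: "card (even_on Ks) = length (even_lists Ks)"
  using even_lists[where Ks = Ks] by (simp add: card_image distinct_card)

lemma dvd_card_even_on:
  assumes "list_all (\<lambda>xs. length xs mod m = 0) (even_lists Ks)" "A \<in> even_on Ks"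
  shows "m dvd card A"
  using assms even_lists(1,4)[where Ks = Ks] by (fastforce simp: list_all_iff)

lemma sym_diff_even_on:
  assumes "A \<in> even_on Ks" "B \<in> even_on Ks"
  shows "sym_diff A B \<in> even_on Ks"
proof -
  have fin: "finite A" "finite B" using assms by (auto simp: even_on_def intro: finite_subset)
  have "even (card (sym_diff A B \<inter> set K))" if "K \<in> set Ks" for K
  proof -
    have "sym_diff A B \<inter> set K = sym_diff (A \<inter> set K) (B \<inter> set K)" by auto
    moreover have "even (card (A \<inter> set K))" "even (card (B \<inter> set K))"
      using assms that by (auto simp: even_on_def)
    ultimately show ?thesis
      using card_sym_diff[of "A \<inter> set K" "B \<inter> set K"] fin
      by (metis dvd_add_right_iff dvd_triv_left even_add finite_Int)
  qed
  then show ?thesis using assms by (auto simp: even_on_def)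
qed

text \<open>
  The words \<open>(a + x | b + x | a + b + x)\<close> on three copies of the 8 points.
\<close>

definition turyn :: "nat set \<Rightarrow> nat set \<Rightarrow> nat set \<Rightarrow> (nat \<times> nat) set" where
  "turyn a b x =
     {0} \<times> sym_diff a x \<union> {1} \<times> sym_diff b x \<union> {2} \<times> sym_diff (sym_diff a b) x"

definition golay :: "(nat \<times> nat) set set" where
  "golay = {turyn a b x |a b x. a \<in> even_on fano \<and> b \<in> even_on fano \<and> x \<in> even_on fano_neg}"

lemma mem_turyn:
  "(k, i) \<in> turyn a b x \<longleftrightarrow>
     k = 0 \<and> (i \<in> a) \<noteq> (i \<in> x) \<or> k = 1 \<and> (i \<in> b) \<noteq> (i \<in> x) \<or>
     k = 2 \<and> ((i \<in> a) \<noteq> (i \<in> b)) \<noteq> (i \<in> x)"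
  unfolding turyn_def by auto

lemma turyn_sym_diff:
  "sym_diff (turyn a b x) (turyn a' b' x') =
     turyn (sym_diff a a') (sym_diff b b') (sym_diff x x')"
proof (intro set_eqI)
  fix p :: "nat \<times> nat"
  obtain k i where p: "p = (k, i)" by fastforce
  consider "k = 0" | "k = 1" | "k = 2" | "k > 2" by linarith
  then show "p \<in> sym_diff (turyn a b x) (turyn a' b' x') \<longleftrightarrow>
      p \<in> turyn (sym_diff a a') (sym_diff b b') (sym_diff x x')"
    by cases (simp_all add: p mem_turyn; argo)+
qed

lemma golay_sym_diff:
  assumes "c \<in> golay" "d \<in> golay"
  shows "sym_diff c d \<in> golay"
  using assms unfolding golay_def
  by (force simp: turyn_sym_diff intro: sym_diff_even_on)

lemma turyn_inj:
  assumes "turyn a b x = turyn a' b' x'"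
  shows "a = a' \<and> b = b' \<and> x = x'"
proof -
  have "(i \<in> a \<longleftrightarrow> i \<in> a') \<and> (i \<in> b \<longleftrightarrow> i \<in> b') \<and> (i \<in> x \<longleftrightarrow> i \<in> x')" for i
    using assms mem_turyn[of _ i a b x] mem_turyn[of _ i a' b' x']
    by (metis one_neq_zero zero_neq_numeral one_eq_numeral_iff semiring_norm(83))
  then show ?thesis by blast
qed

lemma card_golay: "card golay = 2 ^ 12"
proof -
  have "golay = (\<lambda>(a, b, x). turyn a b x) ` (even_on fano \<times> even_on fano \<times> even_on fano_neg)"
    by (auto simp: golay_def image_iff)
  moreover have "inj_on (\<lambda>(a, b, x). turyn a b x) (even_on fano \<times> even_on fano \<times> even_on fano_neg)"
    by (auto intro!: inj_onI dest: turyn_inj)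
  ultimately have "card golay = card (even_on fano \<times> even_on fano \<times> even_on fano_neg)"
    by (metis card_image)
  then show ?thesis
    by (simp add: card_cartesian_product card_even_on even_lists_fano)
qed

lemma golay_subset: "c \<in> golay \<Longrightarrow> c \<subseteq> {..<3} \<times> {..<8}"
  unfolding golay_def turyn_def even_on_def by auto

text \<open>
  By \<open>|a + x| = |a| + |x| - 2|a \<inter> x|\<close>, the three blocks are even, and their weights add up to
  a multiple of 4, because \<open>|a \<inter> x| + |b \<inter> x| + |(a + b) \<inter> x|\<close> is even. It remains to exclude
  weight 4. The sum of the three blocks is \<open>x\<close>. If \<open>x\<close> lies in both Hamming codes then it is
  empty or full, full is impossible for weight 4, and the blocks are then words of the first code; two
  of them vanish, hence all. Otherwise no block is empty, and three even blocks have weight at least 6.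
\<close>

lemma golay_weights:
  assumes "c \<in> golay"
  shows "4 dvd card c" and "c \<noteq> {} \<Longrightarrow> 8 \<le> card c"
proof -
  obtain a b x where abx: "a \<in> even_on fano" "b \<in> even_on fano" "x \<in> even_on fano_neg"
    and c: "c = turyn a b x" using assms by (auto simp: golay_def)
  define d where "d = sym_diff a b"
  define u v w where "u = sym_diff a x" and "v = sym_diff b x" and "w = sym_diff d x"
  note uvw = u_def v_def w_def[unfolded d_def]
  have fin: "finite a" "finite b" "finite x"
    using abx by (auto simp: even_on_def intro: finite_subset)
  then have finuvw: "finite u" "finite v" "finite w" by (auto simp: uvw)
  have cardc: "card c = card u + card v + card w"
  proof -
    have "card c = card ({0::nat} \<times> u \<union> {1} \<times> v) + card ({2::nat} \<times> w)"
      unfolding c turyn_def uvw[symmetric] using finuvw by (intro card_Un_disjoint) auto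
    also have "card ({0::nat} \<times> u \<union> {1} \<times> v) = card ({0::nat} \<times> u) + card ({1::nat} \<times> v)"
      using finuvw by (intro card_Un_disjoint) auto
    finally show ?thesis by (simp add: card_cartesian_product)
  qed
  have find: "finite d" unfolding d_def using fin by simp
  have ab: "d \<in> even_on fano" unfolding d_def using abx sym_diff_even_on by blast
  have dvd: "4 dvd card a" "4 dvd card b" "4 dvd card d" "4 dvd card x"
    using abx ab dvd_card_even_on even_lists_fano by blast+
  have su: "card u + 2 * card (a \<inter> x) = card a + card x"
    and sv: "card v + 2 * card (b \<inter> x) = card b + card x"
    and sw: "card w + 2 * card (d \<inter> x) = card d + card x"
    unfolding u_def v_def w_def using fin find by (intro card_sym_diff; simp)+
  have "d \<inter> x = sym_diff (a \<inter> x) (b \<inter> x)" unfolding d_def by auto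
  then have sx: "card (d \<inter> x) + 2 * card ((a \<inter> x) \<inter> (b \<inter> x)) = card (a \<inter> x) + card (b \<inter> x)"
    using fin by (metis card_sym_diff finite_Int)
  show four: "4 dvd card c"
  proof -
    have "card c + 2 * (card (a \<inter> x) + card (b \<inter> x) + card (d \<inter> x)) =
        (card u + 2 * card (a \<inter> x)) + (card v + 2 * card (b \<inter> x)) + (card w + 2 * card (d \<inter> x))"
      by (simp add: cardc)
    also have "\<dots> = card a + card b + card d + 3 * card x"
      unfolding su sv sw by simp
    finally have "card c + 2 * (card (a \<inter> x) + card (b \<inter> x) + card (d \<inter> x)) =
        card a + card b + card d + 3 * card x" .
    moreover have "card (a \<inter> x) + card (b \<inter> x) + card (d \<inter> x) =
        2 * (card (d \<inter> x) + card ((a \<inter> x) \<inter> (b \<inter> x)))"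
      using sx by simp
    moreover have "4 dvd card a + card b + card d + 3 * card x"
      using dvd by simp
    ultimately have "4 dvd card c + 4 * (card (d \<inter> x) + card ((a \<inter> x) \<inter> (b \<inter> x)))"
      by simp
    then show ?thesis by (simp only: dvd_add_left_iff dvd_triv_left)
  qed
  have even: "even (card u)" "even (card v)" "even (card w)"
  proof -
    have "even (card u + 2 * card (a \<inter> x))" "even (card v + 2 * card (b \<inter> x))"
      "even (card w + 2 * card (d \<inter> x))"
      unfolding su sv sw using dvd by (auto intro: dvd_trans[of 2 4])
    then show "even (card u)" "even (card v)" "even (card w)" by simp_all
  qed
  show "8 \<le> card c" if "c \<noteq> {}"
  proof (rule ccontr)
    assume "\<not> 8 \<le> card c"
    with four have small: "card c \<le> 4" by presburger
    have xuvw: "x = sym_diff (sym_diff u v) w" unfolding uvw by auto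
    show False
    proof (cases "x \<in> even_on fano")
      case True
      then have "x \<in> even_on (fano @ fano_neg)" using abx by (auto simp: even_on_def)
      then have "8 dvd card x" using dvd_card_even_on even_lists_fano by blast
      moreover have "card x \<le> card c"
      proof -
        have "card x \<le> card (u \<union> v \<union> w)" using xuvw finuvw by (intro card_mono) auto
        also have "\<dots> \<le> card c" unfolding cardc
          by (meson add_le_mono1 card_Un_le le_trans)
        finally show ?thesis .
      qed
      \<comment> \<open>The sum of the blocks has at most 4 elements, so it is not the full set.\<close>
      ultimately have "card x = 0" using small by presburger
      then have x: "x = {}" using fin by simp
      have "4 dvd card u" "4 dvd card v" "4 dvd card w"
        using dvd unfolding u_def v_def w_def x by simp_all
      then have "card u = 0 \<or> 4 \<le> card u" "card v = 0 \<or> 4 \<le> card v" "card w = 0 \<or> 4 \<le> card w"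
        by (meson dvd_imp_le not_gr_zero)+
      then have "card u + card v = 0 \<or> card u + card w = 0 \<or> card v + card w = 0"
        using small unfolding cardc by linarith
      then have "u = {} \<and> v = {} \<or> u = {} \<and> w = {} \<or> v = {} \<and> w = {}"
        using finuvw by auto
      then have "a = {} \<and> b = {}" unfolding uvw x by auto
      then have "c = {}" unfolding c x turyn_def by simp
      with that show False ..
    next
      case False
      have "x = sym_diff a u" "x = sym_diff b v" "x = sym_diff d w"
        unfolding u_def v_def w_def by auto
      then have "u \<noteq> {}" "v \<noteq> {}" "w \<noteq> {}"
        using False abx ab by auto
      then have "card u > 0" "card v > 0" "card w > 0" using finuvw by auto
      then have "card u \<ge> 2" "card v \<ge> 2" "card w \<ge> 2" using even by presburger+
      then show False using small cardc by simp
    qed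
  qed
qed

lemma steiner_system_golay:
  "steiner_system 5 8 24 ({..<3} \<times> {..<8}) {c \<in> golay. card c = 8}"
proof (rule steiner_system_of_code)
  show "even (card c)" if "c \<in> golay" for c
    using golay_weights(1)[OF that] by presburger
qed (auto simp: card_golay golay_sym_diff golay_weights(2) card_cartesian_product
      dest: golay_subset)

section \<open>Lower bounds for \<open>h 3 4\<close> and \<open>h 3 15\<close>\<close>

theorem mainTheorem4:
  "(h 3 4 \<ge> card (edges odd_graph_4) + 1 \<and>
    card (edges odd_graph_4) + 1 = 71 \<and>
    (71::nat) > 4^3 - 4^2 + 4 + 2 \<and> (4::nat)^3 - 4^2 + 4 + 2 = 54)
   \<and>
   ((\<forall>(\<Omega> :: 'a set) \<O> p. steiner_system 5 8 24 \<Omega> \<O> \<and> p \<in> \<Omega> \<longrightarrow>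
       h 3 15 \<ge> card (edges (truncated_witt_graph \<O> p)) + 1 \<and>
       card (edges (truncated_witt_graph \<O> p)) + 1 = 3796) \<and>
    h 3 15 \<ge> 3796 \<and>
    (3796::nat) > 15^3 - 15^2 + 15 + 2 \<and> (15::nat)^3 - 15^2 + 15 + 2 = 3167)
   \<and>
   \<not> h 3 4 \<le> 4^3 - 4^2 + 4 + 2 \<and>
   \<not> h 3 15 \<le> 15^3 - 15^2 + 15 + 2"
proof -
  interpret golay: witt_design "{..<3} \<times> {..<8} :: (nat \<times> nat) set" "{c \<in> golay. card c = 8}"
    by unfold_locales (rule steiner_system_golay)
  have h15: "3796 \<le> h 3 15"
    using golay.truncated_witt[of "(0, 0)"] by simp
  have W: "\<forall>(\<Omega> :: 'a set) \<O> p. steiner_system 5 8 24 \<Omega> \<O> \<and> p \<in> \<Omega> \<longrightarrow>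
      h 3 15 \<ge> card (edges (truncated_witt_graph \<O> p)) + 1 \<and>
      card (edges (truncated_witt_graph \<O> p)) + 1 = 3796"
  proof (intro allI impI)
    fix \<Omega> :: "'a set" and \<O> p
    assume *: "steiner_system 5 8 24 \<Omega> \<O> \<and> p \<in> \<Omega>"
    then interpret witt_design \<Omega> \<O> by unfold_locales simp
    show "h 3 15 \<ge> card (edges (truncated_witt_graph \<O> p)) + 1 \<and>
        card (edges (truncated_witt_graph \<O> p)) + 1 = 3796"
      using truncated_witt[of p] * by simp
  qed
  have h4: "71 \<le> h 3 4" using odd_graph_4 by simp
  show ?thesis
    by (intro conjI W) (use odd_graph_4 h4 h15 in simp_all)
qed

end
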